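(* Let $\mathcal{P}_\rho$ be the set of all Borel probability measures $\Pr_\rho$ on $\mathbb{R}^{n_\rho}$ with $\Pr_\rho(\Delta)=1$ (i.e. the only information available on $\rho$ is the support $\Delta$), and let $$\overline{p}=\sup_{\Pr_\rho\in\mathcal{P}_\rho}\Pr_\rho\big(\{\rho\in\Delta:\Lambda(A(\rho))\nsubseteq\mathcal{D}\}\big).$$ Then $\overline{p}$ is either $1$ or $0$. Specifically, $\overline{p}=1$ if $A(\rho)$ is not robustly $\mathcal{D}$-stable with respect to $\Delta$, and $\overline{p}=0$ otherwise.
   Context: Setting. $A(\rho)$ is a real square matrix of size $n_a\times n_a$ whose entries are real polynomials in the uncertain parameter vector $\rho\in\mathbb{R}^{n_\rho}$. The uncertainty set is the compact semialgebraic set $\Delta=\{\rho\in\mathbb{R}^{n_\rho}: g_i(\rho)\ge 0,\ i=1,\dots,n_g\}$, with $g_i$ real polynomials. The stability region $\mathcal{D}\subseteq\mathbb{C}$ is an open set whose complement is the closed semialgebraic set $\mathcal{D}^c=\mathbb{C}\setminus\mathcal{D}=\{\lambda=\lambda_{\mathrm{re}}+j\lambda_{\mathrm{im}}\in\mathbb{C}:\ \lambda_{\mathrm{re}},\lambda_{\mathrm{im}}\in\mathbb{R},\ d_i(\lambda_{\mathrm{re}},\lambda_{\mathrm{im}})\ge 0,\ i=1,\dots,n_d\}$, with $d_i$ real polynomials in the two real variables $\lambda_{\mathrm{re}},\lambda_{\mathrm{im}}$. $\Lambda(M)$ denotes the spectrum (set of complex eigenvalues) of a square matrix $M$. A matrix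 is $\mathcal{D}$-stable if all its eigenvalues belong to $\mathcal{D}$; $A(\rho)$ is robustly $\mathcal{D}$-stable with respect to $\Delta$ if $\Lambda(A(\rho))\subseteq\mathcal{D}$ for every $\rho\in\Delta$. Convention: the supremum over an empty set is taken to be $0$. *)

theory Defs
  imports
    "HOL-Probability.Probability"
    "Jordan_Normal_Form.Spectral_Radius"
begin

definition eigs :: "real mat \<Rightarrow> complex set" where
  "eigs M = spectrum (map_mat complex_of_real M)"

definition D_stable :: "complex set \<Rightarrow> real mat \<Rightarrow> bool" where
  "D_stable D M \<longleftrightarrow> eigs M \<subseteq> D"

definition robustly_D_stable :: "complex set \<Rightarrow> 'p set \<Rightarrow> ('p \<Rightarrow> real mat) \<Rightarrow> bool" where
  "robustly_D_stable D \<Delta> A \<longleftrightarrow> (\<forall>\<rho>\<in>\<Delta>. D_stable D (A \<rho>))"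

definition violation_set :: "complex set \<Rightarrow> 'p set \<Rightarrow> ('p \<Rightarrow> real mat) \<Rightarrow> 'p set" where
  "violation_set D \<Delta> A = {\<rho>\<in>\<Delta>. \<not> eigs (A \<rho>) \<subseteq> D}"

definition borel_probs_on :: "'p::topological_space set \<Rightarrow> 'p measure set" where
  "borel_probs_on \<Delta> = {M. prob_space M \<and> sets M = sets borel \<and> measure M \<Delta> = 1}"

(* The supremum over an empty family is 0 by convention; the library leaves Sup {} unspecified
   on the reals. *)
definition sup_or_zero :: "real set \<Rightarrow> real" where
  "sup_or_zero S = (if S = {} then 0 else Sup S)"

(* measure is 0 on non-measurable sets. The violation set is closed, hence Borel, when \<Delta> is compact,
   A is continuous and D is open. *)
definition worst_case_prob :: "complex set \<Rightarrow> 'p::topological_space set \<Rightarrow> ('p \<Rightarrow> real mat) \<Rightarrow> real" where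
  "worst_case_prob D \<Delta> A =
     sup_or_zero ((\<lambda>M. measure M (violation_set D \<Delta> A)) ` borel_probs_on \<Delta>)"

end

theory Submission
  imports Defs
begin

text \<open>By the Leibniz formula the determinant is a finite sum of signed products of entries.
  The dimension is fixed only on \<open>S\<close>, so the formula replaces \<open>det\<close> under
  a congruence on \<open>S\<close>.\<close>

lemma continuous_on_det:
  fixes B :: "'a::topological_space \<Rightarrow> 'b::{real_normed_algebra_1, comm_ring_1} mat"
  assumes dim: "\<And>x. x \<in> S \<Longrightarrow> B x \<in> carrier_mat n n"
    and cont: "\<And>i j. i < n \<Longrightarrow> j < n \<Longrightarrow> continuous_on S (\<lambda>x. B x $$ (i, j))"
  shows "continuous_on S (\<lambda>x. det (B x))"
proof -
  have "continuous_on S (\<lambda>x. \<Sum>p | p permutes {0..<n}. signof p * (\<Prod>i = 0..<n. B x $$ (i, p i)))"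
    by (intro continuous_intros cont) (auto simp: permutes_in_image)
  also have "?this \<longleftrightarrow> ?thesis"
    by (intro continuous_on_cong) (auto simp: det_def'[OF dim])
  finally show ?thesis .
qed

text \<open>Turns membership in the spectrum into the vanishing of a determinant, which depends
  continuously on the matrix and on \<open>l\<close> jointly.\<close>

lemma eigs_iff_det:
  assumes "M \<in> carrier_mat n n"
  shows "l \<in> eigs M \<longleftrightarrow> det (char_matrix (map_mat complex_of_real M) l) = 0"
  using assms by (simp add: eigs_def spectrum_def eigenvalue_det[of _ n])

text \<open>Cutting the complement of \<open>D\<close> down to closed balls exhibits the violation set as a countable
  union of projections of compact sets, so no bound on the eigenvalues is needed.\<close>

lemma violation_set_borel:
  fixes A :: "'p::t2_space \<Rightarrow> real mat"
  assumes dim: "\<And>\<rho>. \<rho> \<in> \<Delta> \<Longrightarrow> A \<rho> \<in> carrier_mat n n"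
    and cont: "\<And>i j. i < n \<Longrightarrow> j < n \<Longrightarrow> continuous_on \<Delta> (\<lambda>\<rho>. A \<rho> $$ (i, j))"
    and "compact \<Delta>" "open D"
  shows "violation_set D \<Delta> A \<in> sets borel"
proof -
  define f where "f = (\<lambda>(\<rho>, l). det (char_matrix (map_mat complex_of_real (A \<rho>)) l))"
  \<comment> \<open>Since \<open>D\<close> is open, removing it from a closed ball leaves a compact
    set of candidate eigenvalues.\<close>
  define K where "K = (\<lambda>k::nat. \<Delta> \<times> (cball 0 (real k) - D))"
  have compact: "compact (K k)" for k
    unfolding K_def using assms by (intro compact_Times compact_diff compact_cball)
  have "continuous_on (K k) f" for k
    unfolding f_def case_prod_beta
  proof (rule continuous_on_det)
    fix x assume "x \<in> K k"
    then show "char_matrix (map_mat complex_of_real (A (fst x))) (snd x) \<in> carrier_mat n n"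
      using dim by (auto simp: K_def)
  next
    fix i j assume ij: "i < n" "j < n"
    have "continuous_on (K k) (\<lambda>x. A (fst x) $$ (i, j))"
      by (rule continuous_on_compose2[OF cont[OF ij]])
        (auto simp: K_def intro!: continuous_intros)
    \<comment> \<open>This is the entry of \<open>char_matrix\<close>, that is of the matrix minus
      \<open>l\<close> times the identity, written out; whether \<open>i = j\<close> does not depend
      on the point, so the two cases are treated separately.\<close>
    then have "continuous_on (K k)
        (\<lambda>x. complex_of_real (A (fst x) $$ (i, j)) + (if i = j then - snd x else 0))"
      by (cases "i = j") (auto intro!: continuous_intros)
    also have "?this \<longleftrightarrow> continuous_on (K k)
        (\<lambda>x. char_matrix (map_mat complex_of_real (A (fst x))) (snd x) $$ (i, j))"
    proof (intro continuous_on_cong refl)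
      fix x assume "x \<in> K k"
      then have "A (fst x) \<in> carrier_mat n n"
        using dim by (auto simp: K_def)
      then show "complex_of_real (A (fst x) $$ (i, j)) + (if i = j then - snd x else 0) =
          char_matrix (map_mat complex_of_real (A (fst x))) (snd x) $$ (i, j)"
        using ij by (auto simp: char_matrix_def)
    qed
    finally show "continuous_on (K k)
        (\<lambda>x. char_matrix (map_mat complex_of_real (A (fst x))) (snd x) $$ (i, j))" .
  qed
  then have "closed (K k \<inter> f -` {0})" for k
    using compact by (intro continuous_closed_preimage compact_imp_closed) auto
  \<comment> \<open>Continuity of \<open>f\<close> is known only on \<open>K k\<close>, so the zero
    set is closed only after intersection with \<open>K k\<close>; the repeated factor gives the
    shape compact meets closed.\<close>
  then have "compact (K k \<inter> (K k \<inter> f -` {0}))" for k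
    using compact by (intro compact_Int_closed)
  then have "compact (K k \<inter> f -` {0})" for k
    by (simp only: Int_left_absorb)
  \<comment> \<open>A projection of a closed set need not be closed, but that of a compact set is
    compact, hence closed in a Hausdorff space.\<close>
  then have "closed (fst ` (K k \<inter> f -` {0}))" for k
    by (intro compact_imp_closed compact_continuous_image continuous_intros)
  then have "(\<Union>k. fst ` (K k \<inter> f -` {0})) \<in> sets borel"
    by (intro sets.countable_UN) auto
  also have "(\<Union>k. fst ` (K k \<inter> f -` {0})) = violation_set D \<Delta> A"
  proof (intro Set.set_eqI iffI)
    fix \<rho> assume "\<rho> \<in> violation_set D \<Delta> A"
    then obtain l where l: "\<rho> \<in> \<Delta>" "l \<in> eigs (A \<rho>)" "l \<notin> D"
      by (auto simp: violation_set_def)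
    obtain k :: nat where "norm l \<le> real k"
      using real_arch_simple by blast
    with l have "(\<rho>, l) \<in> K k \<inter> f -` {0}"
      using eigs_iff_det[OF dim] by (auto simp: K_def f_def)
    then show "\<rho> \<in> (\<Union>k. fst ` (K k \<inter> f -` {0}))"
      by force
  qed (use eigs_iff_det[OF dim] in \<open>auto simp: violation_set_def K_def f_def\<close>)
  finally show ?thesis .
qed

text \<open>\<open>return borel x\<close> is the Dirac measure at \<open>x\<close>; placed at a
  violating point it is the worst-case distribution.\<close>

lemma return_in_borel_probs_on:
  assumes "x \<in> \<Delta>" "\<Delta> \<in> sets borel"
  shows "return borel x \<in> borel_probs_on \<Delta>"
  using assms by (auto simp: borel_probs_on_def measure_return intro: prob_space_return)

text \<open>The violation set is empty, so every admissible measure gives it 0; if no measure is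
  admissible, the convention in \<open>sup_or_zero\<close> gives 0 as well.\<close>

lemma worst_case_prob_eq_0:
  assumes "robustly_D_stable D \<Delta> A"
  shows "worst_case_prob D \<Delta> A = 0"
proof -
  have "violation_set D \<Delta> A = {}"
    using assms by (auto simp: violation_set_def robustly_D_stable_def D_stable_def)
  then show ?thesis
    by (auto simp: worst_case_prob_def sup_or_zero_def image_constant_conv)
qed

text \<open>The Dirac measure at a violating point attains the upper bound 1 of all probabilities.
  Measurability of the violation set matters, as \<open>measure\<close> would otherwise return
  0.\<close>

lemma worst_case_prob_eq_1:
  assumes "\<not> robustly_D_stable D \<Delta> A"
    and "\<Delta> \<in> sets borel" "violation_set D \<Delta> A \<in> sets borel"
  shows "worst_case_prob D \<Delta> A = 1"
proof -
  let ?P = "(\<lambda>M. measure M (violation_set D \<Delta> A)) ` borel_probs_on \<Delta>"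
  obtain \<rho> where \<rho>: "\<rho> \<in> \<Delta>" "\<rho> \<in> violation_set D \<Delta> A"
    using assms(1) by (auto simp: violation_set_def robustly_D_stable_def D_stable_def)
  then have "measure (return borel \<rho>) (violation_set D \<Delta> A) = 1"
    using assms(3) by (simp add: measure_return)
  then have 1: "1 \<in> ?P"
    using return_in_borel_probs_on[OF \<rho>(1) assms(2)] by (metis imageI)
  moreover have "p \<le> 1" if "p \<in> ?P" for p
    using that by (auto simp: borel_probs_on_def intro: prob_space.prob_le_1)
  ultimately have "Sup ?P = 1"
    by (intro cSup_eq_maximum)
  \<comment> \<open>Membership of 1 in \<open>?P\<close> also excludes the empty case of
    \<open>sup_or_zero\<close>.\<close>
  with 1 show ?thesis
    by (auto simp: worst_case_prob_def sup_or_zero_def)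
qed

theorem theorem1:
  fixes A :: "real ^ 'n \<Rightarrow> real mat"
    and g :: "nat \<Rightarrow> real ^ 'n \<Rightarrow> real"
    and d :: "nat \<Rightarrow> real \<times> real \<Rightarrow> real"
    and \<Delta> :: "(real ^ 'n) set"
    and D :: "complex set"
    and na ng nd :: nat
  assumes A_dim: "\<And>\<rho>. A \<rho> \<in> carrier_mat na na"
    and A_poly: "\<And>i j. i < na \<Longrightarrow> j < na \<Longrightarrow> real_polynomial_function (\<lambda>\<rho>. A \<rho> $$ (i, j))"
    and g_poly: "\<And>i. i \<in> {1..ng} \<Longrightarrow> real_polynomial_function (g i)"
    and Delta: "\<Delta> = {\<rho>. \<forall>i\<in>{1..ng}. g i \<rho> \<ge> 0}"
    and Delta_compact: "compact \<Delta>"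
    and d_poly: "\<And>i. i \<in> {1..nd} \<Longrightarrow> real_polynomial_function (d i)"
    and D_open: "open D"
    and D_compl: "- D = {l. \<forall>i\<in>{1..nd}. d i (Re l, Im l) \<ge> 0}"
  shows "(worst_case_prob D \<Delta> A = 1 \<or> worst_case_prob D \<Delta> A = 0)
    \<and> (\<not> robustly_D_stable D \<Delta> A \<longrightarrow> worst_case_prob D \<Delta> A = 1)
    \<and> (robustly_D_stable D \<Delta> A \<longrightarrow> worst_case_prob D \<Delta> A = 0)"
proof -
  \<comment> \<open>Polynomial dependence on \<rho> enters through continuity of the
    entries.\<close>
  have "continuous_on \<Delta> (\<lambda>\<rho>. A \<rho> $$ (i, j))" if "i < na" "j < na" for i j
    using A_poly[OF that]
    by (simp add: continuous_on_polymonial_function flip: real_polynomial_function_eq)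
  then have "violation_set D \<Delta> A \<in> sets borel"
    using A_dim Delta_compact D_open by (intro violation_set_borel)
  moreover have "\<Delta> \<in> sets borel"
    using Delta_compact by (intro borel_closed compact_imp_closed)
  ultimately show ?thesis
    using worst_case_prob_eq_0 worst_case_prob_eq_1 by blast
qed

end
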